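(* Let $\Gamma\subseteq\mathrm{Sym}(N)$ be a permutation group and let $v$ be a $\Gamma$-arrangement. Then the arrangement space $U\subseteq\mathbb{R}^n$ of $v$ is $\Gamma$-invariant, i.e. $P_\phi U=U$ for all $\phi\in\Gamma$.
   Context: Let $n\ge 1$ and $N=\{1,\dots,n\}$. A ($d$-dimensional) arrangement is a family of points $v_i\in\mathbb{R}^d$, $i\in N$. Its matrix $M\in\mathbb{R}^{n\times d}$ has $i$-th row $v_i^\top$, and its arrangement space is the column span $U=\mathrm{span}\,M\subseteq\mathbb{R}^n$. For a permutation group $\Gamma\subseteq\mathrm{Sym}(N)$, an arrangement $v$ in $\mathbb{R}^d$ is a $\Gamma$-arrangement if there is a group homomorphism $T\colon\Gamma\to\mathrm{O}(\mathbb{R}^d)$, called a representation of $v$, with $T_\phi v_i=v_{\phi(i)}$ for all $i\in N$, $\phi\in\Gamma$. The group $\Gamma$ acts on $\mathbb{R}^n$ by the permutation matrices $P_\phi$, where $P_\phi e_i=e_{\phi(i)}$ for the standard basis vectors $e_i$. *)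

theory Defs
  imports
    "HOL-Algebra.Sym_Groups"
    "Jordan_Normal_Form.VS_Connect"
begin

text \<open>
  Points of an arrangement are indexed by \<open>{1..n}\<close>, matching \<^const>\<open>sym_group\<close>, whereas entries of
  vectors and matrices are indexed from \<open>0\<close>; hence the index \<open>i \<in> {1..n}\<close> corresponds to the
  coordinate \<open>i - 1\<close>. An element of \<open>sym_group n\<close> is a function on all of \<open>nat\<close> that is the
  identity outside \<open>{1..n}\<close>.
\<close>

definition arrangement :: "nat \<Rightarrow> nat \<Rightarrow> (nat \<Rightarrow> real vec) \<Rightarrow> bool" where
  "arrangement n d v \<longleftrightarrow> (\<forall>i\<in>{1..n}. v i \<in> carrier_vec d)"

definition arrangement_matrix :: "nat \<Rightarrow> nat \<Rightarrow> (nat \<Rightarrow> real vec) \<Rightarrow> real mat" where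
  "arrangement_matrix n d v = mat_of_rows d (map v [1..<Suc n])"

definition arrangement_space :: "nat \<Rightarrow> nat \<Rightarrow> (nat \<Rightarrow> real vec) \<Rightarrow> real vec set" where
  "arrangement_space n d v = vec_space.col_space n (arrangement_matrix n d v)"

definition orthogonal_group :: "nat \<Rightarrow> real mat monoid" where
  "orthogonal_group d =
    \<lparr>carrier = {A \<in> carrier_mat d d. A\<^sup>T * A = 1\<^sub>m d \<and> A * A\<^sup>T = 1\<^sub>m d},
     mult = (*), one = 1\<^sub>m d\<rparr>"

lemma group_orthogonal_group: "group (orthogonal_group d)"
proof (rule groupI)
  fix A B assume "A \<in> carrier (orthogonal_group d)" "B \<in> carrier (orthogonal_group d)"
  then have A: "A \<in> carrier_mat d d" "A\<^sup>T * A = 1\<^sub>m d" "A * A\<^sup>T = 1\<^sub>m d"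
    and B: "B \<in> carrier_mat d d" "B\<^sup>T * B = 1\<^sub>m d" "B * B\<^sup>T = 1\<^sub>m d"
    by (auto simp: orthogonal_group_def)
  note C = A(1) B(1) transpose_carrier_mat[THEN iffD2, OF A(1)]
    transpose_carrier_mat[THEN iffD2, OF B(1)]
  have T: "(A * B)\<^sup>T = B\<^sup>T * A\<^sup>T" by (rule transpose_mult[OF C(1,2)])
  have "B\<^sup>T * A\<^sup>T * (A * B) = B\<^sup>T * (A\<^sup>T * (A * B))"
    by (rule assoc_mult_mat[OF C(4,3) mult_carrier_mat[OF C(1,2)]])
  also have "A\<^sup>T * (A * B) = A\<^sup>T * A * B" by (rule assoc_mult_mat[OF C(3,1,2), symmetric])
  finally have 1: "B\<^sup>T * A\<^sup>T * (A * B) = 1\<^sub>m d" by (simp only: A(2) B(2) left_mult_one_mat[OF C(2)])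
  have "A * B * (B\<^sup>T * A\<^sup>T) = A * (B * (B\<^sup>T * A\<^sup>T))"
    by (rule assoc_mult_mat[OF C(1,2) mult_carrier_mat[OF C(4,3)]])
  also have "B * (B\<^sup>T * A\<^sup>T) = B * B\<^sup>T * A\<^sup>T" by (rule assoc_mult_mat[OF C(2,4,3), symmetric])
  finally have 2: "A * B * (B\<^sup>T * A\<^sup>T) = 1\<^sub>m d" by (simp only: A(3) B(3) left_mult_one_mat[OF C(3)])
  show "A \<otimes>\<^bsub>orthogonal_group d\<^esub> B \<in> carrier (orthogonal_group d)"
    using mult_carrier_mat[OF C(1,2)] by (simp add: orthogonal_group_def T 1 2)
next
  fix A assume "A \<in> carrier (orthogonal_group d)"
  then show "\<exists>B\<in>carrier (orthogonal_group d). B \<otimes>\<^bsub>orthogonal_group d\<^esub> A = \<one>\<^bsub>orthogonal_group d\<^esub>"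
    by (intro bexI[of _ "A\<^sup>T"]) (auto simp: orthogonal_group_def)
next
  fix A B C
  assume "A \<in> carrier (orthogonal_group d)" "B \<in> carrier (orthogonal_group d)"
    "C \<in> carrier (orthogonal_group d)"
  then have "A \<in> carrier_mat d d" "B \<in> carrier_mat d d" "C \<in> carrier_mat d d"
    by (simp_all add: orthogonal_group_def)
  from assoc_mult_mat[OF this]
  show "A \<otimes>\<^bsub>orthogonal_group d\<^esub> B \<otimes>\<^bsub>orthogonal_group d\<^esub> C =
    A \<otimes>\<^bsub>orthogonal_group d\<^esub> (B \<otimes>\<^bsub>orthogonal_group d\<^esub> C)"
    by (simp add: orthogonal_group_def)
qed (auto simp: orthogonal_group_def intro: left_mult_one_mat)

definition representation_of ::
    "nat \<Rightarrow> nat \<Rightarrow> (nat \<Rightarrow> nat) set \<Rightarrow> (nat \<Rightarrow> real vec) \<Rightarrow> ((nat \<Rightarrow> nat) \<Rightarrow> real mat) \<Rightarrow> bool" where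
  "representation_of n d \<Gamma> v T \<longleftrightarrow>
    T \<in> hom (sym_group n\<lparr>carrier := \<Gamma>\<rparr>) (orthogonal_group d) \<and>
    (\<forall>\<phi>\<in>\<Gamma>. \<forall>i\<in>{1..n}. T \<phi> *\<^sub>v v i = v (\<phi> i))"

definition symmetric_arrangement ::
    "nat \<Rightarrow> nat \<Rightarrow> (nat \<Rightarrow> nat) set \<Rightarrow> (nat \<Rightarrow> real vec) \<Rightarrow> bool" where
  "symmetric_arrangement n d \<Gamma> v \<longleftrightarrow> arrangement n d v \<and> (\<exists>T. representation_of n d \<Gamma> v T)"

definition std_basis :: "nat \<Rightarrow> nat \<Rightarrow> real vec" where
  "std_basis n i = unit_vec n (i - 1)"

text \<open>The columns, in order, are the basis vectors indexed by \<open>\<phi> 1, \<dots>, \<phi> n\<close>.\<close>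

definition perm_matrix :: "nat \<Rightarrow> (nat \<Rightarrow> nat) \<Rightarrow> real mat" where
  "perm_matrix n \<phi> = mat_of_cols n (map (\<lambda>i. std_basis n (\<phi> i)) [1..<Suc n])"

lemma perm_matrix_mult_std_basis:
  assumes "i \<in> {1..n}"
  shows "perm_matrix n \<phi> *\<^sub>v std_basis n i = std_basis n (\<phi> i)"
proof -
  have c: "perm_matrix n \<phi> \<in> carrier_mat n n"
    unfolding perm_matrix_def by (rule carrier_matI) (simp_all del: upt_Suc)
  have e: "perm_matrix n \<phi> $$ (k, i - 1) = std_basis n (\<phi> i) $ k" if "k < n" for k
    using assms that unfolding perm_matrix_def
    by (subst mat_of_cols_index) (auto simp del: upt_Suc)
  show ?thesis
  proof (rule eq_vecI)
    fix k assume "k < dim_vec (std_basis n (\<phi> i))"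
    then have k: "k < n" by (simp add: std_basis_def)
    have "(perm_matrix n \<phi> *\<^sub>v std_basis n i) $ k = row (perm_matrix n \<phi>) k \<bullet> unit_vec n (i - 1)"
      using c k by (simp add: std_basis_def)
    also have "\<dots> = row (perm_matrix n \<phi>) k $ (i - 1)"
      using assms c by (intro scalar_prod_right_unit) auto
    also have "\<dots> = std_basis n (\<phi> i) $ k"
      using assms c k e by (subst index_row) auto
    finally show "(perm_matrix n \<phi> *\<^sub>v std_basis n i) $ k = std_basis n (\<phi> i) $ k" .
  qed (use c in \<open>simp add: std_basis_def\<close>)
qed

definition invariant_under :: "nat \<Rightarrow> (nat \<Rightarrow> nat) set \<Rightarrow> real vec set \<Rightarrow> bool" where
  "invariant_under n \<Gamma> U \<longleftrightarrow> (\<forall>\<phi>\<in>\<Gamma>. (\<lambda>u. perm_matrix n \<phi> *\<^sub>v u) ` U = U)"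

end

theory Submission
  imports Defs
begin

text \<open>
  Let \<open>M\<close> be the matrix of the arrangement and \<open>A = T \<phi>\<close> the orthogonal matrix representing a
  permutation \<open>\<phi>\<close>. The permutation matrix moves coordinate \<open>i\<close> to coordinate \<open>\<phi> i\<close>, so the
  coordinate of \<open>P M x\<close> at \<open>\<phi> i\<close> is the inner product of \<open>v i\<close> and \<open>x\<close>. As \<open>A\<close> preserves inner
  products, it is also that of \<open>A (v i) = v (\<phi> i)\<close> and \<open>A x\<close>, which is the coordinate of \<open>M A x\<close> at
  \<open>\<phi> i\<close>. Every coordinate has the form \<open>\<phi> i\<close>, so \<open>P M = M A\<close>: permuting coordinates of the
  arrangement space amounts to an orthogonal change of the parameter \<open>x\<close>
  (\<open>perm_matrix_intertwines_representation\<close>). The arrangement space consists of the vectors \<open>M x\<close>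
  with \<open>x \<in> \<real>\<^sup>d\<close>, hence \<open>P\<close> maps it into itself; and it maps it onto itself because \<open>x = A (A\<^sup>T x)\<close>.
\<close>

lemma perm_matrix_carrier: "perm_matrix n \<phi> \<in> carrier_mat n n"
  unfolding perm_matrix_def by (rule carrier_matI) (simp_all del: upt_Suc)

text \<open>
  Row \<open>\<phi> i\<close> of the permutation matrix is the \<open>i\<close>-th unit row, because \<open>\<phi>\<close> is injective: the only
  column with a \<open>1\<close> in that row is the one belonging to \<open>i\<close>.
\<close>

lemma perm_matrix_mult_vec_index:
  assumes perm: "\<phi> permutes {1..n}" and i: "i \<in> {1..n}" and u: "u \<in> carrier_vec n"
  shows "(perm_matrix n \<phi> *\<^sub>v u) $ (\<phi> i - 1) = u $ (i - 1)"
proof -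
  note P = perm_matrix_carrier[of n \<phi>]
  have \<phi>: "\<phi> k \<in> {1..n}" if "k \<in> {1..n}" for k
    using permutes_in_image[OF perm] that by blast
  have row: "row (perm_matrix n \<phi>) (\<phi> i - 1) = unit_vec n (i - 1)"
  proof (rule eq_vecI)
    fix k assume "k < dim_vec (unit_vec n (i - 1) :: real vec)"
    then have k: "k < n" by simp
    have lt: "\<phi> i - 1 < n" "\<phi> (Suc k) - 1 < n" "i - 1 < n"
      using \<phi>[OF i] \<phi>[of "Suc k"] k i by auto
    have "row (perm_matrix n \<phi>) (\<phi> i - 1) $ k = unit_vec n (\<phi> (Suc k) - 1) $ (\<phi> i - 1)"
      using P k lt by (simp add: perm_matrix_def mat_of_cols_index std_basis_def del: upt_Suc)
    also have "\<dots> = unit_vec n (i - 1) $ k"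
    proof -
      have "\<phi> i - 1 = \<phi> (Suc k) - 1 \<longleftrightarrow> \<phi> i = \<phi> (Suc k)"
        using \<phi>[OF i] \<phi>[of "Suc k"] k by auto
      also have "\<dots> \<longleftrightarrow> i = Suc k"
        using inj_eq[OF permutes_inj[OF perm]] .
      also have "\<dots> \<longleftrightarrow> k = i - 1"
        using i by auto
      finally show ?thesis using lt k by (simp add: unit_vec_def)
    qed
    finally show "row (perm_matrix n \<phi>) (\<phi> i - 1) $ k = unit_vec n (i - 1) $ k" .
  qed (use P in simp)
  have "(perm_matrix n \<phi> *\<^sub>v u) $ (\<phi> i - 1) = unit_vec n (i - 1) \<bullet> u"
    using P \<phi>[OF i] row by (subst index_mult_mat_vec) auto
  also have "\<dots> = u $ (i - 1)"
    using i u by (intro scalar_prod_left_unit) auto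
  finally show ?thesis .
qed

lemma arrangement_matrix_carrier: "arrangement_matrix n d v \<in> carrier_mat n d"
  unfolding arrangement_matrix_def by (rule carrier_matI) (simp_all del: upt_Suc)

lemma arrangement_matrix_mult_vec_index:
  assumes "arrangement n d v" and "i \<in> {1..n}"
  shows "(arrangement_matrix n d v *\<^sub>v x) $ (i - 1) = v i \<bullet> x"
proof -
  have "v i \<in> carrier_vec d" using assms by (simp add: arrangement_def)
  then have "row (arrangement_matrix n d v) (i - 1) = v i"
    using assms(2) unfolding arrangement_matrix_def
    by (subst mat_of_rows_row) (auto simp del: upt_Suc)
  then show ?thesis
    using assms(2) arrangement_matrix_carrier[of n d v] by (subst index_mult_mat_vec) auto
qed

lemma arrangement_space_eq_image:
  "arrangement_space n d v = (\<lambda>x. arrangement_matrix n d v *\<^sub>v x) ` carrier_vec d"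
  using arrangement_matrix_carrier[of n d v] mult_mat_vec_carrier[OF arrangement_matrix_carrier]
  unfolding arrangement_space_def vec_space.col_space_eq[OF arrangement_matrix_carrier] by auto

lemma scalar_prod_orthogonal:
  fixes A :: "real mat"
  assumes A: "A \<in> carrier_mat d d" "A\<^sup>T * A = 1\<^sub>m d"
    and x: "x \<in> carrier_vec d" and y: "y \<in> carrier_vec d"
  shows "(A *\<^sub>v x) \<bullet> (A *\<^sub>v y) = x \<bullet> y"
proof -
  have "(A *\<^sub>v x) \<bullet> (A *\<^sub>v y) = (A\<^sup>T *\<^sub>v (A *\<^sub>v x)) \<bullet> y"
    using transpose_vec_mult_scalar[OF A(1) y, of "A *\<^sub>v x"] A(1) x by simp
  also have "A\<^sup>T *\<^sub>v (A *\<^sub>v x) = (A\<^sup>T * A) *\<^sub>v x"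
    using A(1) x by (subst assoc_mult_mat_vec[of _ d d _ d]) auto
  finally show ?thesis using A(2) x by simp
qed

text \<open>
  The factor on the right is \<open>A\<close> and not its inverse: the points are the rows of the matrix, and
  moving them by \<open>A\<close> is undone in every inner product by moving the argument by \<open>A\<close> as well.
\<close>

lemma perm_matrix_intertwines_representation:
  assumes v: "arrangement n d v" and perm: "\<phi> permutes {1..n}"
    and A: "A \<in> carrier_mat d d" "A\<^sup>T * A = 1\<^sub>m d"
    and rep: "\<And>i. i \<in> {1..n} \<Longrightarrow> A *\<^sub>v v i = v (\<phi> i)"
    and x: "x \<in> carrier_vec d"
  shows "perm_matrix n \<phi> *\<^sub>v (arrangement_matrix n d v *\<^sub>v x) = arrangement_matrix n d v *\<^sub>v (A *\<^sub>v x)"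
proof (rule eq_vecI)
  let ?M = "arrangement_matrix n d v"
  fix k assume "k < dim_vec (?M *\<^sub>v (A *\<^sub>v x))"
  then have "Suc k \<in> \<phi> ` {1..n}"
    using arrangement_matrix_carrier[of n d v] permutes_image[OF perm] by auto
  then obtain i where i: "i \<in> {1..n}" and k: "k = \<phi> i - 1" by auto
  have \<phi>i: "\<phi> i \<in> {1..n}" using permutes_in_image[OF perm] i by blast
  have vi: "v i \<in> carrier_vec d" using v i by (simp add: arrangement_def)
  have "(perm_matrix n \<phi> *\<^sub>v (?M *\<^sub>v x)) $ k = (?M *\<^sub>v x) $ (i - 1)"
    unfolding k using perm i mult_mat_vec_carrier[OF arrangement_matrix_carrier x]
    by (rule perm_matrix_mult_vec_index)
  also have "\<dots> = v i \<bullet> x" by (rule arrangement_matrix_mult_vec_index[OF v i])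
  also have "\<dots> = v (\<phi> i) \<bullet> (A *\<^sub>v x)"
    using scalar_prod_orthogonal[OF A vi x] rep[OF i] by simp
  also have "\<dots> = (?M *\<^sub>v (A *\<^sub>v x)) $ k"
    unfolding k by (rule arrangement_matrix_mult_vec_index[OF v \<phi>i, symmetric])
  finally show "(perm_matrix n \<phi> *\<^sub>v (?M *\<^sub>v x)) $ k = (?M *\<^sub>v (A *\<^sub>v x)) $ k" .
qed (use perm_matrix_carrier[of n \<phi>] arrangement_matrix_carrier[of n d v] in simp)

lemma orthogonal_mult_vec_image:
  fixes A :: "real mat"
  assumes A: "A \<in> carrier_mat d d" "A * A\<^sup>T = 1\<^sub>m d"
  shows "(\<lambda>x. A *\<^sub>v x) ` carrier_vec d = carrier_vec d"
proof (intro equalityI subsetI)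
  fix x :: "real vec" assume x: "x \<in> carrier_vec d"
  have "A *\<^sub>v (A\<^sup>T *\<^sub>v x) = (A * A\<^sup>T) *\<^sub>v x"
    using A(1) x by (subst assoc_mult_mat_vec[of _ d d _ d]) auto
  then have "x = A *\<^sub>v (A\<^sup>T *\<^sub>v x)" using A(2) x by simp
  moreover have "A\<^sup>T *\<^sub>v x \<in> carrier_vec d" using A(1) x by auto
  ultimately show "x \<in> (\<lambda>x. A *\<^sub>v x) ` carrier_vec d" by blast
qed (use A(1) in auto)

theorem theorem4p8:
  fixes n d :: nat and \<Gamma> :: "(nat \<Rightarrow> nat) set" and v :: "nat \<Rightarrow> real vec"
  assumes "n \<ge> 1"
    and "subgroup \<Gamma> (sym_group n)"
    and "symmetric_arrangement n d \<Gamma> v"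
  shows "invariant_under n \<Gamma> (arrangement_space n d v)"
  unfolding invariant_under_def
proof
  fix \<phi> assume \<phi>: "\<phi> \<in> \<Gamma>"
  let ?M = "arrangement_matrix n d v"
  have perm: "\<phi> permutes {1..n}"
    using subgroup.mem_carrier[OF assms(2) \<phi>] by (simp add: sym_group_carrier)
  from assms(3) obtain T where v: "arrangement n d v" and T: "representation_of n d \<Gamma> v T"
    unfolding symmetric_arrangement_def by blast
  have "T \<phi> \<in> carrier (orthogonal_group d)"
    using T \<phi> by (auto simp: representation_of_def hom_def)
  then have A: "T \<phi> \<in> carrier_mat d d" "(T \<phi>)\<^sup>T * T \<phi> = 1\<^sub>m d" "T \<phi> * (T \<phi>)\<^sup>T = 1\<^sub>m d"
    by (simp_all add: orthogonal_group_def)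
  have rep: "T \<phi> *\<^sub>v v i = v (\<phi> i)" if "i \<in> {1..n}" for i
    using T \<phi> that by (simp add: representation_of_def)
  have "(\<lambda>u. perm_matrix n \<phi> *\<^sub>v u) ` arrangement_space n d v
      = (\<lambda>x. ?M *\<^sub>v (T \<phi> *\<^sub>v x)) ` carrier_vec d"
    unfolding arrangement_space_eq_image image_image
    by (intro image_cong refl perm_matrix_intertwines_representation[OF v perm A(1,2) rep])
  also have "\<dots> = (\<lambda>x. ?M *\<^sub>v x) ` ((\<lambda>x. T \<phi> *\<^sub>v x) ` carrier_vec d)"
    by (simp only: image_image)
  also have "\<dots> = arrangement_space n d v"
    by (simp only: orthogonal_mult_vec_image[OF A(1,3)] arrangement_space_eq_image)
  finally show "(\<lambda>u. perm_matrix n \<phi> *\<^sub>v u) ` arrangement_space n d v = arrangement_space n d v" .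
qed

end
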